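(* If $G$ is a connected graph on at least two vertices and $m$ is either $1$ or a prime number, then the corona $G \circ \overline{K}_m$ has no perfect state transfer (between any two distinct vertices).
   Context: Graphs are finite, simple and undirected; $A(X)$ denotes the adjacency matrix of a graph $X$, and $e_u$ the standard basis vector indexed by vertex $u$. $\overline{K}_m$ is the empty (edgeless) graph on $m$ vertices. The corona $G\circ H$ of graphs $G,H$ has vertex set $V(G)\times(\{0\}\cup V(H))$ (where $0\notin V(H)$), and $(v,w)$ is adjacent to $(v',w')$ iff one of the following holds: $w=w'=0$ and $v,v'$ are adjacent in $G$; or $v=v'$ and $w,w'\in V(H)$ are adjacent in $H$; or $v=v'$ and exactly one of $w,w'$ equals $0$. There is perfect state transfer between distinct vertices $u,v$ of a graph $X$ at time $\tau$ if $|e_v^T e^{-\mathrm{i}\tau A(X)}e_u|=1$. *)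

theory Defs
  imports "HOL-Analysis.Analysis" "HOL-Computational_Algebra.Primes"
begin

text \<open>
  A finite simple undirected graph is a symmetric irreflexive relation on a finite type;
  the vertex set is the whole type.
\<close>

definition simple_graph :: "('v::finite) rel \<Rightarrow> bool" where
  "simple_graph G \<longleftrightarrow> sym G \<and> irrefl G"

definition connected_graph :: "('v::finite) rel \<Rightarrow> bool" where
  "connected_graph G \<longleftrightarrow> (\<forall>u v. (u, v) \<in> G\<^sup>*)"

definition empty_graph :: "('v::finite) rel" where
  "empty_graph = {}"

text \<open>
  The extra symbol \<open>0 \<notin> V(H)\<close> is \<^const>\<open>None\<close>, and a vertex \<open>w\<close> of \<open>H\<close> appears as \<open>Some w\<close>.
\<close>

definition corona :: "('v::finite) rel \<Rightarrow> ('w::finite) rel \<Rightarrow> ('v \<times> 'w option) rel" where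
  "corona G H = {((v, w), (v', w')).
      (w = None \<and> w' = None \<and> (v, v') \<in> G) \<or>
      (v = v' \<and> (\<exists>x y. w = Some x \<and> w' = Some y \<and> (x, y) \<in> H)) \<or>
      (v = v' \<and> (w = None) \<noteq> (w' = None))}"

definition adjacency_matrix :: "('v::finite) rel \<Rightarrow> complex^'v^'v" where
  "adjacency_matrix X = (\<chi> u v. if (u, v) \<in> X then 1 else 0)"

primrec matrix_pow :: "complex^'n^'n \<Rightarrow> nat \<Rightarrow> complex^'n^'n" where
  "matrix_pow A 0 = mat 1"
| "matrix_pow A (Suc k) = A ** matrix_pow A k"

definition matrix_exp :: "complex^'n^'n \<Rightarrow> complex^'n^'n" where
  "matrix_exp A = (\<Sum>k. matrix_pow A k /\<^sub>R fact k)"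

text \<open>
  To be used for distinct vertices \<open>u\<close> and \<open>v\<close>. Here \<open>axis u 1\<close> is the basis vector \<open>e\<^sub>u\<close>, and
  taking the \<open>v\<close>-th component is multiplication with the transpose of \<open>e\<^sub>v\<close> from the left.
\<close>

definition perfect_state_transfer :: "('v::finite) rel \<Rightarrow> 'v \<Rightarrow> 'v \<Rightarrow> real \<Rightarrow> bool" where
  "perfect_state_transfer X u v \<tau> \<longleftrightarrow>
     cmod ((matrix_exp (map_matrix ((*) (- \<i> * of_real \<tau>)) (adjacency_matrix X)) *v axis u 1) $ v) = 1"

lemma simple_graph_empty: "simple_graph empty_graph"
  by (simp add: simple_graph_def empty_graph_def sym_def irrefl_def)

lemma simple_graph_corona:
  assumes "simple_graph G" "simple_graph H"
  shows "simple_graph (corona G H)"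
  using assms by (auto simp: simple_graph_def corona_def sym_def irrefl_def)

text \<open>The exponential series converges for every matrix.\<close>

lemma matrix_exp_sums: "(\<lambda>k. matrix_pow A k /\<^sub>R fact k) sums matrix_exp A"
proof -
  define c where "c = (\<Sum>i\<in>UNIV. \<Sum>j\<in>UNIV. cmod (A $ i $ j))"
  have row: "(\<Sum>j\<in>UNIV. cmod (A $ i $ j)) \<le> c" for i
    unfolding c_def by (rule member_le_sum) (auto intro: sum_nonneg)
  have c0: "c \<ge> 0" unfolding c_def by (intro sum_nonneg) auto
  have entry: "cmod (matrix_pow A k $ i $ j) \<le> c ^ k" for k i j
  proof (induction k arbitrary: i)
    case 0
    then show ?case by (simp add: mat_def)
  next
    case (Suc k)
    have "cmod (matrix_pow A (Suc k) $ i $ j)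
          \<le> (\<Sum>l\<in>UNIV. cmod (A $ i $ l) * cmod (matrix_pow A k $ l $ j))"
      by (simp add: matrix_matrix_mult_def) (rule order_trans[OF norm_sum], simp add: norm_mult)
    also have "\<dots> \<le> (\<Sum>l\<in>UNIV. cmod (A $ i $ l) * c ^ k)"
      by (intro sum_mono mult_left_mono Suc.IH) auto
    also have "\<dots> \<le> c * c ^ k"
      using row[of i] c0 by (simp add: sum_distrib_right[symmetric] mult_right_mono)
    finally show ?case by simp
  qed
  have "norm (matrix_pow A k) \<le> (\<Sum>i\<in>UNIV. norm (matrix_pow A k $ i))" for k
    by (simp add: norm_vec_def L2_set_le_sum)
  also have "(\<Sum>i\<in>UNIV. norm (matrix_pow A k $ i))
      \<le> (\<Sum>i\<in>UNIV. \<Sum>j\<in>UNIV. cmod (matrix_pow A k $ i $ j))" for k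
    by (intro sum_mono) (simp add: norm_vec_def L2_set_le_sum)
  also have "(\<Sum>i\<in>UNIV. \<Sum>j\<in>UNIV. cmod (matrix_pow A k $ i $ j))
      \<le> (\<Sum>i\<in>(UNIV::'a set). \<Sum>j\<in>(UNIV::'a set). c ^ k)" for k
    by (intro sum_mono entry)
  finally have bnd: "norm (matrix_pow A k) \<le> (real CARD('a))\<^sup>2 * c ^ k" for k
    by (simp add: power2_eq_square mult.assoc)
  have "summable (\<lambda>k. (real CARD('a))\<^sup>2 * (c ^ k /\<^sub>R fact k))"
    by (intro summable_mult summable_exp_generic)
  then have "summable (\<lambda>k. matrix_pow A k /\<^sub>R fact k)"
  proof (rule summable_comparison_test'[where N = 0])
    fix k
    show "norm (matrix_pow A k /\<^sub>R fact k) \<le> (real CARD('a))\<^sup>2 * (c ^ k /\<^sub>R fact k)"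
      using bnd[of k] by (simp add: field_simps)
  qed
  then show ?thesis
    unfolding matrix_exp_def by (rule summable_sums)
qed

end

theory Submission
  imports Defs
begin

text \<open>
  Write \<open>X\<close> for the corona, \<open>A\<close> for the adjacency matrix of \<open>G\<close>, and let perfect state transfer
  take place from \<open>x = (u, a)\<close> to \<open>y = (v, b)\<close> at time \<open>\<tau>\<close>. The transition matrix \<open>U\<close> is unitary, so
  its column at \<open>x\<close> is \<open>\<gamma>\<close> times the basis vector at \<open>y\<close>, with \<open>\<bar>\<gamma>\<bar> = 1\<close>. As \<open>U\<close> is also
  symmetric, pairing this column with a real eigenvector \<open>Z\<close> of \<open>X\<close> for \<open>\<theta>\<close> gives
  \<open>exp (- \<i> \<tau> \<theta>) Z(x) = \<gamma> Z(y)\<close> (\<open>perfect_state_transfer_eigenvectors\<close>). Everything else is deduced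
  from this relation and from the spectral theorem for symmetric matrices, in the form that a vector
  orthogonal to all eigenvectors is zero (\<open>graph_eigenvectors_complete\<close>); the latter shows, for
  instance, that \<open>\<tau> \<noteq> 0\<close>.

  The eigenvectors of \<open>X\<close> come from two sources. An eigenvector \<open>z\<close> of \<open>G\<close> for \<open>\<mu>\<close> lifts to \<open>\<theta> z\<close> on
  \<open>G\<close> and \<open>z\<close> on each layer of leaves, for both roots \<open>\<alpha> > 0\<close> and \<open>- m / \<alpha>\<close> of
  \<open>\<theta>\<^sup>2 = \<mu> \<theta> + m\<close>; the difference of two leaves at the same vertex is an eigenvector for \<open>0\<close>.

  Call \<open>\<mu>\<close> a support eigenvalue if it has an eigenvector \<open>z\<close> with \<open>z(u) \<noteq> 0\<close>. As \<open>u\<close> is not isolated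
  there are at least two of them. By the relation above, the corresponding values \<open>\<theta>\<close> differ
  by integer multiples of \<open>\<pi> / \<tau>\<close>. If \<open>\<alpha>, \<beta>\<close> are the positive roots of two distinct support eigenvalues, then
  \<open>\<alpha> + m / \<alpha>\<close>, \<open>\<beta> + m / \<beta>\<close> and \<open>\<alpha> - \<beta>\<close> are such multiples, which forces \<open>\<alpha> \<beta>\<close> and \<open>\<alpha>\<^sup>2\<close> to be
  rational (\<open>lattice_differences_rational\<close>). Rational eigenvalues of the integer matrix
  \<open>A(X)\<^sup>2\<close> are integers, so \<open>\<alpha>\<^sup>2\<close> and \<open>(m / \<alpha>)\<^sup>2\<close> are integers with product \<open>m\<^sup>2\<close>. For \<open>m\<close> equal to \<open>1\<close>
  or prime, \<open>\<alpha>\<close> is \<open>1\<close>, \<open>\<surd>m\<close> or \<open>m\<close>; for prime \<open>m\<close>, \<open>\<surd>m\<close> is excluded because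
  \<open>\<alpha> \<beta>\<close> is rational.
  Hence \<open>\<mu> = \<plusminus>(m - 1)\<close> (\<open>corona_support_eigenvalues\<close>). If \<open>m = 1\<close> this is a single value, a
  contradiction. Let \<open>m\<close> be prime.

  If \<open>x\<close> or \<open>y\<close> is a leaf, the leaf differences show that \<open>x\<close> and \<open>y\<close> are leaves at the same vertex,
  that \<open>m = 2\<close> and that \<open>\<gamma> = - 1\<close>; the phases at \<open>\<theta> = 2\<close> and \<open>\<theta> = - 1\<close> are then incompatible.

  If \<open>x\<close> and \<open>y\<close> are both in \<open>G\<close>, then on the eigenvectors for \<open>m - 1\<close> one has \<open>z(v) = s z(u)\<close>, and on
  those for \<open>1 - m\<close> one has \<open>z(v) = s' z(u)\<close>, with signs \<open>s, s'\<close>; for all other eigenvalues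
  \<open>z(u) = z(v) = 0\<close>. If \<open>s = s'\<close>, the basis vectors at \<open>u\<close> and \<open>v\<close> are proportional, which is absurd.
  If \<open>s' = - s\<close>, then \<open>A e\<^sub>u = (m - 1) s e\<^sub>v\<close>; comparing entries gives \<open>m = 2\<close>, and again the phases
  are incompatible.
\<close>

section \<open>Spectral decomposition of graphs\<close>

text \<open>
  The eigenvector maximises \<open>f x \<bullet> x\<close> on the unit sphere of \<open>W\<close>.
\<close>

lemma self_adjoint_eigenvector_in_subspace:
  fixes f :: "'a::euclidean_space \<Rightarrow> 'a"
  assumes lin: "linear f" and sa: "\<And>x y. f x \<bullet> y = x \<bullet> f y"
    and W: "subspace W" and inv: "\<And>x. x \<in> W \<Longrightarrow> f x \<in> W" and ne: "w \<in> W" "w \<noteq> 0"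
  obtains x \<mu> where "x \<in> W" "x \<noteq> 0" "f x = \<mu> *\<^sub>R x"
proof -
  define S where "S = W \<inter> sphere 0 1"
  have "compact S"
    unfolding S_def using closed_subspace[OF W] by (simp add: closed_Int_compact)
  moreover have "w /\<^sub>R norm w \<in> S"
    using ne subspace_scale[OF W] by (simp add: S_def)
  then have "S \<noteq> {}" by blast
  moreover have "continuous_on S (\<lambda>x. f x \<bullet> x)"
    using linear_continuous_on[of f S] lin
    by (intro continuous_intros) (simp add: linear_conv_bounded_linear)
  ultimately obtain x where xS: "x \<in> S" and max: "\<And>y. y \<in> S \<Longrightarrow> f y \<bullet> y \<le> f x \<bullet> x"
    using continuous_attains_sup[of S "\<lambda>x. f x \<bullet> x"] by blast
  have xW: "x \<in> W" and nx: "norm x = 1" using xS by (auto simp: S_def)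
  define \<mu> where "\<mu> = f x \<bullet> x"
  define g where "g y = \<mu> *\<^sub>R y - f y" for y
  have lg: "linear g"
    unfolding g_def using lin by (intro linear_compose_sub linear_scale_self) auto
  have gW: "g y \<in> W" if "y \<in> W" for y
    unfolding g_def using that W inv by (simp add: subspace_diff subspace_scale)
  have g_sa: "g a \<bullet> b = a \<bullet> g b" for a b
    by (simp add: g_def inner_diff_left inner_diff_right sa)
  have g_pos: "g y \<bullet> y \<ge> 0" if y: "y \<in> W" for y
  proof (cases "y = 0")
    case False
    have "y /\<^sub>R norm y \<in> S" using False y subspace_scale[OF W] by (simp add: S_def)
    from max[OF this] have "(f y \<bullet> y) / (norm y)\<^sup>2 \<le> \<mu>"
      using linear_scale[OF lin] by (simp add: \<mu>_def power2_eq_square divide_inverse algebra_simps)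
    then have "f y \<bullet> y \<le> \<mu> * (norm y)\<^sup>2" using False by (simp add: divide_le_eq)
    then show ?thesis by (simp add: g_def inner_diff_left power2_norm_eq_inner)
  qed (simp add: g_def)
  have gx: "g x \<bullet> x = 0"
    using nx by (simp add: g_def \<mu>_def inner_diff_left flip: power2_norm_eq_inner)
  \<comment> \<open>\<open>g\<close> is positive semidefinite on \<open>W\<close> and \<open>x\<close> is isotropic for it. Moving from \<open>x\<close> in the
    direction \<open>g x\<close> shows that \<open>g x = 0\<close>.\<close>
  define r where "r = g x \<bullet> g x"
  define s where "s = g (g x) \<bullet> g x"
  have quad: "0 \<le> 2 * t * r + t\<^sup>2 * s" for t
  proof -
    have "0 \<le> g (x + t *\<^sub>R g x) \<bullet> (x + t *\<^sub>R g x)"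
      using xW gW W by (intro g_pos) (simp add: subspace_add subspace_scale)
    also have "\<dots> = g x \<bullet> x + t * (g (g x) \<bullet> x) + t * r + t\<^sup>2 * s"
      by (simp add: linear_add[OF lg] linear_scale[OF lg] r_def s_def inner_add_left
          inner_add_right power2_eq_square algebra_simps)
    also have "g (g x) \<bullet> x = r" by (simp add: g_sa r_def)
    finally show ?thesis by (simp add: gx algebra_simps)
  qed
  have "r = 0"
  proof (rule ccontr)
    assume "r \<noteq> 0"
    then have r: "r > 0" by (simp add: r_def)
    have s: "s \<ge> 0" unfolding s_def by (intro g_pos gW xW)
    define t where "t = - r / (s + 1)"
    have ts: "t * (s + 1) = - r" using s by (simp add: t_def)
    have "t < 0" using r s by (simp add: t_def field_simps)
    have "2 * t * r + t\<^sup>2 * s = t * (2 * r + (t * (s + 1) - t))"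
      by (simp add: power2_eq_square algebra_simps)
    also have "\<dots> = t * (r - t)" unfolding ts by simp
    also have "\<dots> < 0" using \<open>t < 0\<close> r by (simp add: mult_neg_pos)
    finally show False using quad[of t] by simp
  qed
  then have "f x = \<mu> *\<^sub>R x" by (simp add: r_def g_def)
  moreover have "x \<noteq> 0" using nx by auto
  ultimately show ?thesis using xW that by blast
qed

lemma orthogonal_to_eigenvectors_eq_0:
  fixes f :: "'a::euclidean_space \<Rightarrow> 'a"
  assumes lin: "linear f" and sa: "\<And>x y. f x \<bullet> y = x \<bullet> f y"
    and orth: "\<And>z \<mu>. f z = \<mu> *\<^sub>R z \<Longrightarrow> w \<bullet> z = 0"
  shows "w = 0"
proof (rule ccontr)
  define W where "W = {w. \<forall>z \<mu>. f z = \<mu> *\<^sub>R z \<longrightarrow> w \<bullet> z = 0}"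
  assume "w \<noteq> 0"
  moreover have "w \<in> W" using orth by (auto simp: W_def)
  moreover have "subspace W" by (auto simp: W_def subspace_def inner_add_left)
  moreover have "f x \<in> W" if "x \<in> W" for x using that by (auto simp: W_def sa)
  ultimately obtain x \<mu> where "x \<in> W" "x \<noteq> 0" "f x = \<mu> *\<^sub>R x"
    using self_adjoint_eigenvector_in_subspace[OF lin sa] by metis
  then show False by (auto simp: W_def)
qed

text \<open>
  \<open>z\<close> lies in the eigenspace of the adjacency matrix of \<open>X\<close> for the real number \<open>\<theta>\<close>. The zero
  vector is admitted.
\<close>

definition graph_eigenvector :: "('v::finite) rel \<Rightarrow> real \<Rightarrow> ('v \<Rightarrow> real) \<Rightarrow> bool" where
  "graph_eigenvector X \<theta> z \<longleftrightarrow> (\<forall>i. (\<Sum>j | (i, j) \<in> X. z j) = \<theta> * z i)"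

lemma graph_eigenvectors_complete:
  fixes X :: "('v::finite) rel"
  assumes "sym X" and orth: "\<And>z \<theta>. graph_eigenvector X \<theta> z \<Longrightarrow> (\<Sum>i\<in>UNIV. w i * z i) = 0"
  shows "w i = 0"
proof -
  define f :: "real^'v \<Rightarrow> real^'v" where "f x = (\<chi> i. \<Sum>j | (i, j) \<in> X. x $ j)" for x
  have "(\<chi> i. w i) = (0 :: real^'v)"
  proof (rule orthogonal_to_eigenvectors_eq_0)
    show "linear f"
      by (rule linearI) (auto simp: f_def vec_eq_iff sum.distrib sum_distrib_left)
  next
    fix x y
    have "f x \<bullet> y = (\<Sum>i\<in>UNIV. \<Sum>j\<in>UNIV. if (i, j) \<in> X then x $ j * y $ i else 0)"
      by (simp add: f_def inner_vec_def sum_distrib_right sum.If_cases)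
    also have "\<dots> = (\<Sum>j\<in>UNIV. \<Sum>i\<in>UNIV. if (i, j) \<in> X then x $ j * y $ i else 0)"
      by (rule sum.swap)
    also have "\<dots> = (\<Sum>j\<in>UNIV. \<Sum>i\<in>UNIV. if (j, i) \<in> X then x $ j * y $ i else 0)"
      using \<open>sym X\<close> by (intro sum.cong refl) (auto dest: symD)
    also have "\<dots> = x \<bullet> f y"
      by (simp add: f_def inner_vec_def sum_distrib_left sum.If_cases)
    finally show "f x \<bullet> y = x \<bullet> f y" .
  next
    fix z \<mu> assume "f z = \<mu> *\<^sub>R z"
    then have "graph_eigenvector X \<mu> (($) z)"
      by (simp add: graph_eigenvector_def f_def vec_eq_iff)
    then show "(\<chi> i. w i) \<bullet> z = 0" using orth by (simp add: inner_vec_def)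
  qed
  then show ?thesis by (simp add: vec_eq_iff)
qed

text \<open>
  The eigenvectors are not annihilated by \<open>e\<^sub>u - c e\<^sub>v\<close>, since this vector is nonzero.
\<close>

lemma graph_eigenvectors_separate:
  fixes X :: "('v::finite) rel"
  assumes "sym X" "u \<noteq> v"
  obtains \<theta> z where "graph_eigenvector X \<theta> z" "z u \<noteq> c * z v"
proof (rule ccontr)
  assume "\<not> thesis"
  with that have all: "z u = c * z v" if "graph_eigenvector X \<theta> z" for \<theta> z
    using that by blast
  have "(if u = u then 1 else if u = v then - c else 0) = (0::real)"
  proof (rule graph_eigenvectors_complete[OF \<open>sym X\<close>,
      where w = "\<lambda>i. if i = u then 1 else if i = v then - c else 0"])
    fix z \<theta> assume "graph_eigenvector X \<theta> z"
    have "(\<Sum>i\<in>UNIV. (if i = u then 1 else if i = v then - c else 0) * z i)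
      = (\<Sum>i\<in>UNIV. (if i = u then z i else 0) + (if i = v then - c * z i else 0))"
      using \<open>u \<noteq> v\<close> by (intro sum.cong) auto
    also have "\<dots> = z u - c * z v" by (simp add: sum.distrib)
    finally show "(\<Sum>i\<in>UNIV. (if i = u then 1 else if i = v then - c else 0) * z i) = 0"
      using all[OF \<open>graph_eigenvector X \<theta> z\<close>] by simp
  qed
  then show False by simp
qed

text \<open>
  The conclusion says that the adjacency matrix maps \<open>e\<^sub>u\<close> to \<open>c e\<^sub>v\<close>: both sides have the same inner
  product with every eigenvector.
\<close>

lemma neighbours_if_eigenvectors_proportional:
  fixes X :: "('v::finite) rel"
  assumes "sym X" and all: "\<And>\<theta> z. graph_eigenvector X \<theta> z \<Longrightarrow> \<theta> * z u = c * z v"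
  shows "(if (u, i) \<in> X then 1 else 0) = (if i = v then c else 0)"
proof -
  have "(if (u, i) \<in> X then 1 else 0) - (if i = v then c else 0) = 0"
  proof (rule graph_eigenvectors_complete[OF \<open>sym X\<close>,
      where w = "\<lambda>i. (if (u, i) \<in> X then 1 else 0) - (if i = v then c else 0)"])
    fix z \<theta> assume z: "graph_eigenvector X \<theta> z"
    have "(\<Sum>i\<in>UNIV. ((if (u, i) \<in> X then 1 else 0) - (if i = v then c else 0)) * z i)
      = (\<Sum>i\<in>UNIV. (if (u, i) \<in> X then z i else 0) - (if i = v then c * z i else 0))"
      by (intro sum.cong) (auto simp: left_diff_distrib)
    also have "\<dots> = \<theta> * z u - c * z v"
      using z by (simp add: sum_subtractf graph_eigenvector_def sum.If_cases)
    finally show "(\<Sum>i\<in>UNIV. ((if (u, i) \<in> X then 1 else 0) - (if i = v then c else 0)) * z i) = 0"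
      using all[OF z] by simp
  qed
  then show ?thesis by simp
qed

text \<open>
  Applied twice, this gives two different eigenvalues in the support of a vertex that has a neighbour.
\<close>

lemma support_avoiding_value:
  fixes G :: "('v::finite) rel"
  assumes "simple_graph G" "(u, i) \<in> G"
  obtains \<mu> z where "graph_eigenvector G \<mu> z" "z u \<noteq> 0" "\<mu> \<noteq> c"
proof (rule ccontr)
  assume "\<not> thesis"
  with that have "\<mu> * z u = c * z u" if "graph_eigenvector G \<mu> z" for \<mu> z
    using that by (cases "z u = 0") auto
  with assms neighbours_if_eigenvectors_proportional[of G u c u i]
  have "(1 :: real) = (if i = u then c else 0)" by (auto simp: simple_graph_def)
  moreover have "i \<noteq> u" using assms by (auto simp: simple_graph_def irrefl_def)
  ultimately show False by simp
qed

lemma connected_graph_has_neighbour: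
  fixes G :: "('v::finite) rel"
  assumes "connected_graph G" "CARD('v) \<ge> 2"
  obtains i where "(u, i) \<in> G"
proof -
  have "\<exists>v. v \<noteq> u"
  proof (rule ccontr)
    assume "\<nexists>v. v \<noteq> u"
    then have "(UNIV :: 'v set) = {u}" by auto
    then have "CARD('v) = card {u}" by simp
    then show False using assms(2) by simp
  qed
  then obtain v where "v \<noteq> u" by blast
  moreover have "(u, v) \<in> G\<^sup>*" using assms by (simp add: connected_graph_def)
  ultimately show ?thesis using that by (metis converse_rtranclE)
qed

section \<open>The transition matrix\<close>

lemma matrix_pow_commute: "matrix_pow A k ** A = A ** matrix_pow A k"
  by (induction k) (simp_all flip: matrix_mul_assoc)

lemma transpose_matrix_pow: "transpose (matrix_pow A k) = matrix_pow (transpose A) k"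
  by (induction k) (simp_all add: matrix_transpose_mul matrix_pow_commute transpose_mat)

lemma matrix_exp_component_sums:
  fixes A :: "complex^'n^'n"
  shows "(\<lambda>k. matrix_pow A k $ i $ j /\<^sub>R fact k) sums (matrix_exp A $ i $ j)"
proof -
  have "bounded_linear (\<lambda>M :: complex^'n^'n. M $ i $ j)"
    by (intro bounded_linear_compose[OF bounded_linear_vec_nth bounded_linear_vec_nth])
  from bounded_linear.sums[OF this matrix_exp_sums[of A]] show ?thesis
    by simp
qed

lemma matrix_exp_symmetric:
  assumes "\<And>i j. A $ i $ j = A $ j $ i"
  shows "matrix_exp A $ i $ j = matrix_exp A $ j $ i"
proof -
  have "transpose A = A" using assms by (simp add: transpose_def vec_eq_iff)
  then have "matrix_pow A k $ i $ j = matrix_pow A k $ j $ i" for k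
    using transpose_matrix_pow[of A k] by (simp add: transpose_def vec_eq_iff)
  then show ?thesis
    using matrix_exp_component_sums[of A i j] matrix_exp_component_sums[of A j i]
    by (simp add: sums_unique2)
qed

lemma matrix_exp_eigenvector:
  assumes "A *v z = c *s z"
  shows "matrix_exp A *v z = exp c *s z"
proof -
  have pow: "matrix_pow A k *v z = c ^ k *s z" for k
    by (induction k) (simp_all add: assms vector_scalar_commute flip: matrix_vector_mul_assoc)
  have "(matrix_exp A *v z) $ i = exp c * z $ i" for i
  proof -
    have "(\<lambda>k. \<Sum>j\<in>UNIV. matrix_pow A k $ i $ j /\<^sub>R fact k * z $ j) sums (matrix_exp A *v z) $ i"
      unfolding matrix_vector_mult_def
      unfolding vec_lambda_beta by (intro sums_sum sums_mult2 matrix_exp_component_sums)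
    also have "(\<lambda>k. \<Sum>j\<in>UNIV. matrix_pow A k $ i $ j /\<^sub>R fact k * z $ j)
      = (\<lambda>k. (matrix_pow A k *v z) $ i /\<^sub>R fact k)"
      by (simp add: matrix_vector_mult_def scaleR_sum_right)
    also have "\<dots> = (\<lambda>k. (c ^ k /\<^sub>R fact k) * z $ i)" by (simp add: pow)
    finally show ?thesis
      using sums_mult2[OF exp_converges[of c], of "z $ i"] by (rule sums_unique2)
  qed
  then show ?thesis by (simp add: vec_eq_iff)
qed

text \<open>
  Every real eigenvector \<open>z\<close> of \<open>X\<close>, with eigenvalue \<open>\<theta>\<close>, satisfies \<open>exp (- \<i> \<tau> \<theta>) z(x) = \<gamma> z(y)\<close>.
  For \<open>z(x) \<noteq> 0\<close> and \<open>\<bar>\<gamma>\<bar> = 1\<close> this contains strong cospectrality (\<open>z(y) = \<plusminus>z(x)\<close>) as well as a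
  condition on the phase at \<open>\<theta>\<close>.
\<close>

definition phase_related :: "('v::finite) rel \<Rightarrow> real \<Rightarrow> complex \<Rightarrow> 'v \<Rightarrow> 'v \<Rightarrow> bool" where
  "phase_related X \<tau> \<gamma> x y \<longleftrightarrow> (\<forall>\<theta> z. graph_eigenvector X \<theta> z
    \<longrightarrow> exp (- \<i> * of_real (\<tau> * \<theta>)) * of_real (z x) = \<gamma> * of_real (z y))"

lemma phase_relatedD:
  assumes "phase_related X \<tau> \<gamma> x y" "graph_eigenvector X \<theta> z"
  shows "exp (- \<i> * of_real (\<tau> * \<theta>)) * of_real (z x) = \<gamma> * of_real (z y)"
  using assms by (simp add: phase_related_def)

lemma perfect_state_transfer_eigenvectors:
  fixes X :: "('v::finite) rel"
  assumes X: "simple_graph X" and pst: "perfect_state_transfer X x y \<tau>"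
  obtains \<gamma> where "cmod \<gamma> = 1" "phase_related X \<tau> \<gamma> x y"
proof -
  have "sym X" using X by (simp add: simple_graph_def)
  define A where "A = map_matrix ((*) (- \<i> * of_real \<tau>)) (adjacency_matrix X)"
  define U where "U = matrix_exp A"
  have A_entry: "A $ i $ j = (if (i, j) \<in> X then - \<i> * of_real \<tau> else 0)" for i j
    by (simp add: A_def adjacency_matrix_def map_matrix_def)
  have U_sym: "U $ i $ j = U $ j $ i" for i j
    unfolding U_def using \<open>sym X\<close> by (intro matrix_exp_symmetric) (auto simp: A_entry dest: symD)
  have eig: "(\<Sum>j\<in>UNIV. U $ i $ j * of_real (z j)) = exp (- \<i> * of_real (\<tau> * \<theta>)) * of_real (z i)"
    if z: "graph_eigenvector X \<theta> z" for \<theta> z i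
  proof -
    have "A *v (\<chi> i. of_real (z i)) = (- \<i> * of_real (\<tau> * \<theta>)) *s (\<chi> i. of_real (z i))"
    proof -
      have "(\<Sum>j\<in>UNIV. A $ i $ j * of_real (z j)) = - \<i> * of_real (\<tau> * \<theta>) * of_real (z i)" for i
      proof -
        have "(\<Sum>j\<in>UNIV. A $ i $ j * of_real (z j))
          = (\<Sum>j\<in>UNIV. if (i, j) \<in> X then - \<i> * of_real \<tau> * of_real (z j) else 0)"
          by (intro sum.cong) (auto simp: A_entry)
        also have "\<dots> = - \<i> * of_real \<tau> * of_real (\<Sum>j | (i, j) \<in> X. z j)"
          by (simp add: sum.If_cases sum_distrib_left sum_negf)
        also have "(\<Sum>j | (i, j) \<in> X. z j) = \<theta> * z i"
          using z by (simp add: graph_eigenvector_def)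
        finally show ?thesis by simp
      qed
      then show ?thesis by (simp add: vec_eq_iff matrix_vector_mult_def)
    qed
    from matrix_exp_eigenvector[OF this] show ?thesis
      by (simp add: vec_eq_iff matrix_vector_mult_def U_def)
  qed
  \<comment> \<open>\<open>U\<close> acts on a real eigenvector by a phase and its conjugate by the inverse phase, so the
    product of the two fixes every real eigenvector.\<close>
  have unitary: "(\<Sum>j\<in>UNIV. cnj (U $ x $ j) * U $ j $ k) = (if x = k then 1 else 0)" for k
  proof -
    define d where "d k = (\<Sum>j\<in>UNIV. cnj (U $ x $ j) * U $ j $ k) - (if k = x then 1 else 0)" for k
    have orth: "(\<Sum>k\<in>UNIV. d k * of_real (z k)) = 0" if z: "graph_eigenvector X \<theta> z" for \<theta> z
    proof -
      let ?e = "exp (- \<i> * of_real (\<tau> * \<theta>))"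
      have "(\<Sum>k\<in>UNIV. \<Sum>j\<in>UNIV. cnj (U $ x $ j) * U $ j $ k * of_real (z k))
        = (\<Sum>j\<in>UNIV. cnj (U $ x $ j) * (\<Sum>k\<in>UNIV. U $ j $ k * of_real (z k)))"
        by (subst sum.swap) (simp add: sum_distrib_left mult.assoc)
      also have "\<dots> = (\<Sum>j\<in>UNIV. ?e * (cnj (U $ x $ j) * of_real (z j)))"
        unfolding eig[OF z] by (intro sum.cong refl mult.left_commute)
      also have "\<dots> = ?e * cnj (\<Sum>j\<in>UNIV. U $ x $ j * of_real (z j))"
        unfolding cnj_sum complex_cnj_mult complex_cnj_complex_of_real by (rule sum_distrib_left[symmetric])
      also have "\<dots> = ?e * cnj ?e * of_real (z x)"
        unfolding eig[OF z] by (simp only: complex_cnj_mult complex_cnj_complex_of_real mult.assoc)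
      also have "?e * cnj ?e = 1"
        using complex_norm_square[of ?e] by (simp add: norm_exp_eq_Re)
      finally have "(\<Sum>k\<in>UNIV. \<Sum>j\<in>UNIV. cnj (U $ x $ j) * U $ j $ k * of_real (z k)) = of_real (z x)"
        by (simp only: mult_1)
      moreover have "(\<Sum>k\<in>UNIV. d k * of_real (z k))
        = (\<Sum>k\<in>UNIV. (\<Sum>j\<in>UNIV. cnj (U $ x $ j) * U $ j $ k * of_real (z k))
             - (if k = x then of_real (z k) else 0))"
        by (intro sum.cong) (auto simp: d_def left_diff_distrib sum_distrib_right)
      ultimately show ?thesis unfolding sum_subtractf by simp
    qed
    have "(\<Sum>k\<in>UNIV. Re (d k) * z k) = 0 \<and> (\<Sum>k\<in>UNIV. Im (d k) * z k) = 0"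
      if "graph_eigenvector X \<theta> z" for \<theta> z
      using orth[OF that] by (simp add: complex_eq_iff)
    then have "Re (d k) = 0" "Im (d k) = 0"
      using graph_eigenvectors_complete[OF \<open>sym X\<close>, of "\<lambda>k. Re (d k)"]
        graph_eigenvectors_complete[OF \<open>sym X\<close>, of "\<lambda>k. Im (d k)"] by blast+
    then have "d k = 0" by (simp add: complex_eq_iff)
    then show ?thesis by (auto simp: d_def split: if_splits)
  qed
  have Uyx: "cmod (U $ y $ x) = 1"
  proof -
    have "(U *v axis x 1) $ y = (\<Sum>j\<in>UNIV. if j = x then U $ y $ j else 0)"
      unfolding matrix_vector_mult_def vec_lambda_beta by (intro sum.cong) (auto simp: axis_def)
    then show ?thesis using pst by (simp add: perfect_state_transfer_def U_def A_def)
  qed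
  have "of_real (\<Sum>j\<in>UNIV. (cmod (U $ j $ x))\<^sup>2) = (1 :: complex)"
    using unitary[of x]
    by (simp only: of_real_sum complex_norm_square U_sym[of x] mult.commute[of "cnj _"] if_True refl)
  then have "(\<Sum>j\<in>UNIV. (cmod (U $ j $ x))\<^sup>2) = 1" by (simp only: of_real_eq_1_iff)
  then have "(\<Sum>j\<in>UNIV - {y}. (cmod (U $ j $ x))\<^sup>2) = 0"
    using Uyx by (simp add: sum.remove[of UNIV y])
  then have other: "U $ j $ x = 0" if "j \<noteq> y" for j
    using that by (simp add: sum_nonneg_eq_0_iff)
  show ?thesis
  proof
    have "exp (- \<i> * of_real (\<tau> * \<theta>)) * of_real (z x) = U $ y $ x * of_real (z y)"
      if z: "graph_eigenvector X \<theta> z" for \<theta> z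
    proof -
      have "(\<Sum>j\<in>UNIV. U $ x $ j * of_real (z j)) = (\<Sum>j\<in>{y}. U $ x $ j * of_real (z j))"
        by (rule sum.mono_neutral_right) (auto simp: U_sym[of x] other)
      then show ?thesis
        by (simp add: eig[OF z] U_sym[of x y])
    qed
    then show "phase_related X \<tau> (U $ y $ x) x y" by (simp add: phase_related_def)
  qed (fact Uyx)
qed

text \<open>
  Both phases are real multiples of \<open>\<gamma>\<close>, so their quotient is real, hence \<open>1\<close> or \<open>- 1\<close>.
\<close>

lemma eigenvalue_differences_in_lattice:
  fixes \<tau> \<theta> \<theta>' a a' b b' :: real
  assumes "exp (- \<i> * of_real (\<tau> * \<theta>)) * of_real a = \<gamma> * of_real b" "a \<noteq> 0"
    and "exp (- \<i> * of_real (\<tau> * \<theta>')) * of_real a' = \<gamma> * of_real b'" "a' \<noteq> 0"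
    and "\<tau> \<noteq> 0"
  obtains k :: int where "\<theta> - \<theta>' = of_int k * (pi / \<tau>)"
proof -
  let ?e = "\<lambda>\<theta>. exp (- \<i> * of_real (\<tau> * \<theta>)) :: complex"
  have "?e \<theta>' * of_real a' \<noteq> 0" using \<open>a' \<noteq> 0\<close> by simp
  then have "\<gamma> * of_real b' \<noteq> 0" by (simp only: assms(3) simp_thms)
  then have nz: "\<gamma> \<noteq> 0" "b' \<noteq> 0" by auto
  have e: "?e \<theta> = \<gamma> * of_real (b / a)" "?e \<theta>' = \<gamma> * of_real (b' / a')"
    using assms(1-4) nz by (simp_all add: eq_divide_eq)
  have "exp (\<i> * of_real (\<tau> * (\<theta>' - \<theta>))) = ?e \<theta> / ?e \<theta>'"
    by (simp add: algebra_simps flip: exp_diff)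
  also have "\<dots> = of_real ((b / a) / (b' / a'))" unfolding e using nz by simp
  finally have "Im (exp (\<i> * of_real (\<tau> * (\<theta>' - \<theta>)))) = 0" by (simp only: Im_complex_of_real)
  then have "sin (\<tau> * (\<theta>' - \<theta>)) = 0" by (simp add: Im_exp)
  then obtain k :: int where "\<tau> * (\<theta>' - \<theta>) = of_int k * pi" by (auto simp: sin_zero_iff_int2)
  then have "\<theta> - \<theta>' = of_int (- k) * (pi / \<tau>)" using \<open>\<tau> \<noteq> 0\<close> by (simp add: field_simps)
  then show ?thesis by (rule that)
qed

section \<open>Integrality\<close>

text \<open>
  The given eigenvector is only real. Simultaneous Diophantine approximation of its entries gives an
  integer vector; if the error is small enough, the eigenvalue equation for it holds up to an integer of
  absolute value less than \<open>1\<close>, hence exactly. Iterating the equation then shows that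
  all powers of the denominator of \<open>\<rho>\<close> divide this vector.
\<close>

lemma integer_matrix_rational_eigenvalue:
  fixes c :: "'v::finite \<Rightarrow> 'v \<Rightarrow> int" and z :: "'v \<Rightarrow> real"
  assumes eig: "\<And>i. (\<Sum>j\<in>UNIV. of_int (c i j) * z j) = \<rho> * z i"
    and "z u \<noteq> 0" and "\<rho> \<in> \<rat>"
  shows "\<rho> \<in> \<int>"
proof -
  from \<open>\<rho> \<in> \<rat>\<close> obtain p q :: int where pq: "\<rho> = of_int p / of_int q" "q > 0" "coprime p q"
    by (auto elim!: Rats_cases')
  \<comment> \<open>The normalisation \<open>y u = 1\<close> ensures that the integer approximation \<open>h\<close> below is nonzero at \<open>u\<close>.\<close>
  define y where "y i = z i / z u" for i
  have eig': "(\<Sum>j\<in>UNIV. of_int (c i j) * y j) = \<rho> * y i" for i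
    using eig[of i] by (simp add: y_def flip: sum_divide_distrib)
  \<comment> \<open>The integer defect of the approximation is less than \<open>K / N\<close>, see the estimate below.\<close>
  define K where "K = (\<Sum>i\<in>UNIV. \<Sum>j\<in>UNIV. \<bar>of_int q * real_of_int (c i j)\<bar>) + \<bar>of_int p\<bar> + 1"
  obtain N :: nat where N: "real N > K" "N > 0"
  proof -
    obtain N where "real N > K" using reals_Archimedean2 by blast
    moreover have "K > 0" unfolding K_def by (intro add_nonneg_pos add_nonneg_nonneg sum_nonneg) auto
    ultimately show ?thesis using that[of N] by (cases N) auto
  qed
  obtain e :: "nat \<Rightarrow> 'v" where e: "bij_betw e {..<CARD('v)} UNIV"
    using ex_bij_betw_nat_finite[of "UNIV :: 'v set"] by (auto simp: atLeast0LessThan)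
  obtain s P where s: "0 < s" and P: "\<And>i. i < CARD('v) \<Longrightarrow> \<bar>of_int s * y (e i) - of_int (P i)\<bar> < 1 / N"
    using Dirichlet_approx_simult[OF \<open>N > 0\<close>, of "CARD('v)" "\<lambda>i. y (e i)"] by metis
  define h where "h v = P (the_inv_into {..<CARD('v)} e v)" for v
  define r where "r v = of_int s * y v - of_int (h v)" for v
  have r: "\<bar>r v\<bar> < 1 / N" for v
  proof -
    let ?k = "the_inv_into {..<CARD('v)} e v"
    have "?k < CARD('v)" "e ?k = v"
      using e the_inv_into_into[of e "{..<CARD('v)}" v "{..<CARD('v)}"]
      by (auto simp: bij_betw_def f_the_inv_into_f)
    then show ?thesis using P[of ?k] by (simp add: r_def h_def)
  qed
  have r_scaled: "\<bar>a * r v\<bar> \<le> \<bar>a\<bar> * (1 / N)" for a v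
    using mult_left_mono[OF less_imp_le[OF r[of v]], of "\<bar>a\<bar>"] by (simp add: abs_mult)
  have int_eig: "q * (\<Sum>j\<in>UNIV. c i j * h j) = p * h i" for i
  proof -
    define t where "t = q * (\<Sum>j\<in>UNIV. c i j * h j) - p * h i"
    have hr: "of_int (h j) = of_int s * y j - r j" for j by (simp add: r_def)
    have "real_of_int t = of_int s * (of_int q * (\<Sum>j\<in>UNIV. of_int (c i j) * y j) - of_int p * y i)
      - ((\<Sum>j\<in>UNIV. of_int q * of_int (c i j) * r j) - of_int p * r i)"
      by (simp add: t_def hr algebra_simps sum_subtractf sum_distrib_left)
    also have "of_int q * (\<Sum>j\<in>UNIV. of_int (c i j) * y j) - of_int p * y i = 0"
      using pq by (simp add: eig')
    finally have "\<bar>real_of_int t\<bar> = \<bar>(\<Sum>j\<in>UNIV. of_int q * of_int (c i j) * r j) - of_int p * r i\<bar>"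
      by simp
    also have "\<dots> \<le> \<bar>\<Sum>j\<in>UNIV. of_int q * of_int (c i j) * r j\<bar> + \<bar>of_int p * r i\<bar>"
      by (rule abs_triangle_ineq4)
    also have "\<dots> \<le> (\<Sum>j\<in>UNIV. \<bar>of_int q * of_int (c i j) * r j\<bar>) + \<bar>of_int p * r i\<bar>"
      by (intro add_right_mono sum_abs)
    also have "\<dots> \<le> (\<Sum>j\<in>UNIV. \<bar>of_int q * of_int (c i j)\<bar> * (1 / N)) + \<bar>of_int p\<bar> * (1 / N)"
      by (intro add_mono sum_mono r_scaled)
    also have "\<dots> = ((\<Sum>j\<in>UNIV. \<bar>of_int q * real_of_int (c i j)\<bar>) + \<bar>of_int p\<bar>) / N"
      by (simp add: sum_distrib_right[symmetric] add_divide_distrib sum_divide_distrib)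
    also have "\<dots> < 1"
    proof -
      have "(\<Sum>j\<in>UNIV. \<bar>of_int q * real_of_int (c i j)\<bar>)
        \<le> (\<Sum>i\<in>UNIV. \<Sum>j\<in>UNIV. \<bar>of_int q * real_of_int (c i j)\<bar>)"
        by (rule member_le_sum) (auto intro: sum_nonneg)
      then show ?thesis using N by (simp add: K_def)
    qed
    finally have "t = 0" by linarith
    then show ?thesis by (simp add: t_def)
  qed
  have div: "q ^ k dvd h i" for k i
  proof (induction k arbitrary: i)
    case (Suc k)
    have "q ^ k dvd (\<Sum>j\<in>UNIV. c i j * h j)" by (intro dvd_sum dvd_mult Suc.IH)
    then have "q ^ Suc k dvd p * h i" by (simp flip: int_eig[of i])
    moreover have "coprime (q ^ Suc k) p" using pq by (simp add: coprime_commute)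
    ultimately show ?case by (simp add: coprime_dvd_mult_right_iff)
  qed simp
  have "h u \<noteq> 0"
  proof
    assume "h u = 0"
    then have "real_of_int s < 1 / N" using r[of u] \<open>z u \<noteq> 0\<close> by (simp add: r_def y_def)
    moreover have "1 / N \<le> 1" using N by simp
    ultimately show False using s by linarith
  qed
  have "q = 1"
  proof (rule ccontr)
    assume "q \<noteq> 1"
    then have "q \<ge> 2" using pq by simp
    let ?k = "nat \<bar>h u\<bar>"
    have "int ?k < 2 ^ ?k" by (metis of_nat_less_two_power)
    also have "\<dots> \<le> q ^ ?k" using \<open>q \<ge> 2\<close> by (intro power_mono) auto
    also have "\<dots> \<le> \<bar>h u\<bar>" using div[of ?k u] \<open>h u \<noteq> 0\<close> by (intro zdvd_imp_le) auto
    finally show False by simp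
  qed
  then show ?thesis using pq by simp
qed

text \<open>
  \<open>\<theta>\<^sup>2\<close> is an eigenvalue of the square of the adjacency matrix.
\<close>

lemma graph_eigenvalue_square_integer:
  fixes X :: "('v::finite) rel"
  assumes z: "graph_eigenvector X \<theta> z" and "z u \<noteq> 0" and "\<theta>\<^sup>2 \<in> \<rat>"
  shows "\<theta>\<^sup>2 \<in> \<int>"
proof (rule integer_matrix_rational_eigenvalue[where u = u and z = z])
  let ?b = "\<lambda>i j. if (i, j) \<in> X then 1 else 0 :: int"
  fix i
  have b: "(\<Sum>j\<in>UNIV. of_int (?b i j) * f j) = (\<Sum>j | (i, j) \<in> X. f j)" for i and f :: "'v \<Rightarrow> real"
    by (simp add: sum.If_cases if_distrib[of real_of_int] if_distrib[of "\<lambda>x. x * _"] cong: if_cong)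
  have "(\<Sum>j\<in>UNIV. of_int (\<Sum>k\<in>UNIV. ?b i k * ?b k j) * z j)
    = (\<Sum>k\<in>UNIV. of_int (?b i k) * (\<Sum>j\<in>UNIV. of_int (?b k j) * z j))"
    unfolding of_int_sum of_int_mult sum_distrib_left sum_distrib_right
    by (subst sum.swap) (simp add: mult.assoc)
  also have "\<dots> = \<theta>\<^sup>2 * z i"
    using z unfolding b by (simp add: graph_eigenvector_def power2_eq_square mult.assoc flip: sum_distrib_left)
  finally show "(\<Sum>j\<in>UNIV. of_int (\<Sum>k\<in>UNIV. ?b i k * ?b k j) * z j) = \<theta>\<^sup>2 * z i" .
qed fact+

text \<open>
  With \<open>q = \<alpha> \<beta>\<close>, comparing \<open>m / \<alpha> - m / \<beta>\<close> with \<open>\<alpha> - \<beta>\<close> shows that \<open>q\<close> is rational. Eliminating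
  \<open>\<beta>\<close> and \<open>\<delta>\<close> from the equations for \<open>k\<close> and \<open>l\<close> gives a linear equation for \<open>\<alpha>\<^sup>2\<close>. It is degenerate
  only for \<open>q = m\<close>; then \<open>\<beta> = m / \<alpha>\<close>, and the equations for \<open>k\<close> and \<open>j\<close> determine \<open>\<alpha>\<^sup>2\<close>.
\<close>

lemma lattice_differences_rational:
  fixes \<alpha> \<beta> m \<delta> :: real and k l j :: int
  assumes pos: "\<alpha> > 0" "\<beta> > 0" "m > 0" and "m \<in> \<rat>" and "\<alpha> \<noteq> \<beta>"
    and k: "\<alpha> + m / \<alpha> = of_int k * \<delta>" and l: "\<beta> + m / \<beta> = of_int l * \<delta>"
    and j: "\<alpha> - \<beta> = of_int j * \<delta>"
  shows "\<alpha> * \<beta> \<in> \<rat>" "\<alpha>\<^sup>2 \<in> \<rat>"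
proof -
  let ?q = "\<alpha> * \<beta>"
  have "\<delta> \<noteq> 0" "j \<noteq> 0" using j \<open>\<alpha> \<noteq> \<beta>\<close> by auto
  have "\<alpha> + m / \<alpha> > 0" using pos by (simp add: add_pos_pos)
  then have "k \<noteq> 0" using k by auto
  have "of_int (k - l - j) * \<delta> = m / \<alpha> - m / \<beta>"
    using k l j by (simp add: algebra_simps)
  also have "\<dots> * ?q = - m * (\<alpha> - \<beta>)" using pos by (simp add: field_simps)
  finally have "of_int (k - l - j) * ?q * \<delta> = - m * of_int j * \<delta>"
    by (simp add: j mult_ac)
  then have q: "of_int (k - l - j) * ?q = - m * of_int j"
    using mult_right_cancel[OF \<open>\<delta> \<noteq> 0\<close>] by blast
  then have "real_of_int (k - l - j) \<noteq> 0" using pos \<open>j \<noteq> 0\<close> by (intro notI) simp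
  then have "?q = - m * of_int j / of_int (k - l - j)"
    by (metis q nonzero_mult_div_cancel_left)
  also have "\<dots> \<in> \<rat>" using \<open>m \<in> \<rat>\<close> by simp
  finally show qQ: "?q \<in> \<rat>" .
  have k': "\<alpha>\<^sup>2 + m = of_int k * \<delta> * \<alpha>" and l': "\<beta>\<^sup>2 + m = of_int l * \<delta> * \<beta>"
    using k l pos by (simp_all add: field_simps power2_eq_square)
  have "(\<alpha>\<^sup>2 + m) * (?q * of_int l) = of_int k * \<alpha>\<^sup>2 * (\<beta>\<^sup>2 + m)"
    unfolding k' l' by (simp add: power2_eq_square)
  then have eq: "\<alpha>\<^sup>2 * (?q * of_int l - of_int k * m) = of_int k * ?q\<^sup>2 - m * ?q * of_int l"
    by (simp add: algebra_simps power2_eq_square)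
  show "\<alpha>\<^sup>2 \<in> \<rat>"
  proof (cases "?q * of_int l = of_int k * m")
    case False
    then have "\<alpha>\<^sup>2 = (of_int k * ?q\<^sup>2 - m * ?q * of_int l) / (?q * of_int l - of_int k * m)"
      using eq by (simp add: eq_divide_eq)
    also have "\<dots> \<in> \<rat>" using qQ \<open>m \<in> \<rat>\<close> by simp
    finally show ?thesis .
  next
    case True
    then have "of_int k * ?q\<^sup>2 = m * (?q * of_int l)" using eq by simp
    also have "\<dots> = of_int k * m\<^sup>2" unfolding True by (simp add: power2_eq_square)
    finally have "?q\<^sup>2 = m\<^sup>2" using \<open>k \<noteq> 0\<close> by simp
    then have "?q = m" using pos by simp
    then have "\<alpha>\<^sup>2 - m = of_int j * \<delta> * \<alpha>"
      using j by (simp add: power2_eq_square algebra_simps flip: j)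
    then have "of_int k * (\<alpha>\<^sup>2 - m) = of_int j * (\<alpha>\<^sup>2 + m)" unfolding k' by simp
    then have *: "\<alpha>\<^sup>2 * of_int (k - j) = m * of_int (k + j)" by (simp add: algebra_simps)
    have "real_of_int (k - j) \<noteq> 0"
    proof
      assume "real_of_int (k - j) = 0"
      then have "k = j" by simp
      then have "m * of_int (k + k) = 0" using * by simp
      then show False using \<open>k \<noteq> 0\<close> pos by simp
    qed
    then have "\<alpha>\<^sup>2 = m * of_int (k + j) / of_int (k - j)"
      by (metis * nonzero_mult_div_cancel_right)
    also have "\<dots> \<in> \<rat>" using \<open>m \<in> \<rat>\<close> by simp
    finally show ?thesis .
  qed
qed

lemma integer_factor_of_square:
  fixes a b :: real and m :: nat
  assumes "m = 1 \<or> prime m" "a \<in> \<int>" "b \<in> \<int>" "a > 0" "b > 0" "a * b = (real m)\<^sup>2"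
  shows "a = 1 \<or> a = m \<or> a = (real m)\<^sup>2"
proof -
  obtain i where i: "a = of_nat i"
    using assms by (metis Ints_cases less_imp_le of_int_0_le_iff of_int_of_nat_eq zero_le_imp_eq_int)
  obtain j where j: "b = of_nat j"
    using assms by (metis Ints_cases less_imp_le of_int_0_le_iff of_int_of_nat_eq zero_le_imp_eq_int)
  have "real (i * j) = real (m\<^sup>2)" using assms i j by simp
  then have "i * j = m\<^sup>2" by (simp only: of_nat_eq_iff)
  then have dvd: "i dvd m\<^sup>2" by (metis dvd_triv_left)
  have "i = 1 \<or> i = m \<or> i = m\<^sup>2"
    using assms(1)
  proof
    assume "m = 1"
    then show ?thesis using dvd by simp
  next
    assume "prime m"
    then obtain k where "k \<le> 2" "i = m ^ k" using dvd by (auto simp: divides_primepow_nat)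
    then show ?thesis by (cases "k = 0"; cases "k = 1"; cases "k = 2") auto
  qed
  then show ?thesis using i by auto
qed

section \<open>Eigenvectors of the corona\<close>

lemma neighbours_corona_base:
  "{j. ((v, None), j) \<in> corona G (empty_graph :: ('w::finite) rel)}
    = (\<lambda>v'. (v', None)) ` {v'. (v, v') \<in> G} \<union> (\<lambda>w. (v, Some w)) ` UNIV"
proof -
  have "(v', a) \<in> (\<lambda>w :: 'w. (v, Some w)) ` UNIV \<longleftrightarrow> v' = v \<and> a \<noteq> None" for v' and a :: "'w option"
    by (cases a) auto
  then show ?thesis by (auto simp: corona_def empty_graph_def)
qed

lemma neighbours_corona_leaf:
  "{j. ((v, Some w), j) \<in> corona G (empty_graph :: ('w::finite) rel)} = {(v, None)}"
  by (auto simp: corona_def empty_graph_def)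

lemma sum_neighbours_corona_base:
  fixes f :: "('v::finite) \<times> ('w::finite) option \<Rightarrow> real"
  shows "(\<Sum>j | ((v, None), j) \<in> corona G (empty_graph :: 'w rel). f j)
    = (\<Sum>v' | (v, v') \<in> G. f (v', None)) + (\<Sum>w\<in>UNIV. f (v, Some w))"
proof -
  have "inj_on (\<lambda>v'. (v', None :: 'w option)) A" for A :: "'v set" by (auto simp: inj_on_def)
  moreover have "inj (\<lambda>w :: 'w. (v, Some w))" by (auto simp: inj_on_def)
  ultimately show ?thesis
    unfolding neighbours_corona_base by (subst sum.union_disjoint) (auto simp: sum.reindex)
qed

text \<open>
  The vector on the corona that is \<open>\<theta> z\<close> on the vertices of \<open>G\<close> and repeats \<open>z\<close> on every layer of leaves.
\<close>

definition corona_lift :: "real \<Rightarrow> ('v \<Rightarrow> real) \<Rightarrow> 'v \<times> 'w option \<Rightarrow> real" where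
  "corona_lift \<theta> z = (\<lambda>(v, a). if a = None then \<theta> * z v else z v)"

lemma corona_eigenvector:
  fixes G :: "('v::finite) rel"
  assumes z: "graph_eigenvector G \<mu> z" and \<theta>: "\<theta>\<^sup>2 = \<mu> * \<theta> + real CARD('w::finite)"
  shows "graph_eigenvector (corona G (empty_graph :: 'w rel)) \<theta> (corona_lift \<theta> z)"
  unfolding graph_eigenvector_def corona_lift_def
proof
  fix i :: "'v \<times> 'w option"
  obtain v a where i: "i = (v, a)" by force
  show "(\<Sum>j | (i, j) \<in> corona G empty_graph. case j of (v, a) \<Rightarrow> if a = None then \<theta> * z v else z v)
    = \<theta> * (case i of (v, a) \<Rightarrow> if a = None then \<theta> * z v else z v)"
  proof (cases a)
    case None
    have "\<theta> * (\<Sum>v' | (v, v') \<in> G. z v') + real CARD('w) * z v = \<theta> * (\<mu> * z v) + real CARD('w) * z v"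
      using z by (simp add: graph_eigenvector_def)
    also have "\<dots> = \<theta>\<^sup>2 * z v" by (simp add: \<theta> algebra_simps)
    finally show ?thesis
      by (simp add: i None sum_neighbours_corona_base sum_distrib_left power2_eq_square mult.assoc)
  qed (simp add: i neighbours_corona_leaf)
qed

lemma corona_twin_eigenvector:
  fixes G :: "('v::finite) rel" and w w' :: "'w::finite"
  assumes "w \<noteq> w'"
  shows "graph_eigenvector (corona G (empty_graph :: 'w rel)) 0
    (\<lambda>p. if p = (u, Some w) then 1 else if p = (u, Some w') then - 1 else 0)"
  unfolding graph_eigenvector_def
proof
  fix i :: "'v \<times> 'w option"
  obtain v a where i: "i = (v, a)" by force
  have "(\<Sum>x\<in>UNIV. if x = w then 1 else if x = w' then - 1 else 0 :: real)
    = (\<Sum>x\<in>UNIV. (if x = w then 1 else 0) - (if x = w' then 1 else 0))"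
    using assms by (intro sum.cong) auto
  also have "\<dots> = 0" by (simp add: sum_subtractf)
  finally show "(\<Sum>j | (i, j) \<in> corona G empty_graph.
      if j = (u, Some w) then 1 else if j = (u, Some w') then - 1 else 0)
    = (0 :: real) * (if i = (u, Some w) then 1 else if i = (u, Some w') then - 1 else 0)"
    by (cases a; cases "v = u") (simp_all add: i neighbours_corona_leaf sum_neighbours_corona_base cong: if_cong)
qed

section \<open>The support of the initial vertex\<close>

text \<open>
  The positive root of \<open>\<theta>\<^sup>2 = \<mu> \<theta> + m\<close>, for \<open>m > 0\<close>. The other root is \<open>- m\<close> divided by it.
\<close>

definition corona_root :: "nat \<Rightarrow> real \<Rightarrow> real" where
  "corona_root m \<mu> = (\<mu> + sqrt (\<mu>\<^sup>2 + 4 * m)) / 2"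

lemma corona_root_pos:
  assumes "m > 0"
  shows "corona_root m \<mu> > 0"
proof -
  have "\<bar>\<mu>\<bar> < sqrt (\<mu>\<^sup>2 + 4 * m)"
    using assms by (intro real_less_rsqrt) auto
  then show ?thesis by (simp add: corona_root_def)
qed

lemma corona_root_root: "(corona_root m \<mu>)\<^sup>2 = \<mu> * corona_root m \<mu> + m"
  by (simp add: corona_root_def power2_sum power_divide field_simps) (simp add: power2_eq_square)

lemma corona_root_conjugate:
  assumes "m > 0"
  shows "(- real m / corona_root m \<mu>)\<^sup>2 = \<mu> * (- real m / corona_root m \<mu>) + m"
proof -
  let ?\<alpha> = "corona_root m \<mu>"
  have "(- real m / ?\<alpha>)\<^sup>2 - \<mu> * (- real m / ?\<alpha>) = m * (m + \<mu> * ?\<alpha>) / ?\<alpha>\<^sup>2"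
    using corona_root_pos[OF assms, of \<mu>] by (simp add: field_simps power2_eq_square)
  also have "\<dots> = m * ?\<alpha>\<^sup>2 / ?\<alpha>\<^sup>2" by (simp only: corona_root_root add.commute)
  also have "\<dots> = m" using corona_root_pos[OF assms, of \<mu>] by simp
  finally show ?thesis by simp
qed

lemma eigenvalue_of_corona_root:
  assumes "m > 0"
  shows "\<mu> = corona_root m \<mu> - real m / corona_root m \<mu>"
  using corona_root_pos[OF assms, of \<mu>] corona_root_root[of m \<mu>]
  by (simp add: field_simps power2_eq_square)

text \<open>
  For two distinct eigenvalues \<open>\<mu>, \<nu>\<close> in the support of \<open>u\<close>, with positive roots \<open>\<alpha>, \<beta>\<close>: the relation
  between the eigenvectors at \<open>(u, a)\<close> and \<open>y\<close> makes \<open>\<alpha> \<beta>\<close> rational and restricts \<open>\<alpha>\<close>.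
\<close>

lemma corona_support_pair:
  fixes G :: "('v::finite) rel" and \<gamma> :: complex and a :: "'w::finite option"
  assumes m: "CARD('w) = m" "m = 1 \<or> prime m" and "\<tau> \<noteq> 0"
    and rel: "phase_related (corona G (empty_graph :: 'w rel)) \<tau> \<gamma> (u, a) y"
    and z: "graph_eigenvector G \<mu> z" "z u \<noteq> 0"
    and z': "graph_eigenvector G \<nu> z'" "z' u \<noteq> 0" and "\<mu> \<noteq> \<nu>"
  shows "corona_root m \<mu> * corona_root m \<nu> \<in> \<rat>"
    "corona_root m \<mu> = 1 \<or> (corona_root m \<mu>)\<^sup>2 = m \<or> corona_root m \<mu> = m"
proof -
  let ?X = "corona G (empty_graph :: 'w rel)"
  let ?x = "(u, a)"
  let ?\<alpha> = "corona_root m"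
  have "m > 0" using m by (metis zero_less_card_finite)
  note \<alpha>_pos = corona_root_pos[OF \<open>m > 0\<close>]
  note \<mu>_eq = eigenvalue_of_corona_root[OF \<open>m > 0\<close>]
  note eig = phase_relatedD[OF rel]
  have L: "graph_eigenvector ?X \<theta> (corona_lift \<theta> z)"
    if "graph_eigenvector G \<mu> z" "\<theta>\<^sup>2 = \<mu> * \<theta> + m" for \<mu> \<theta> z
    using that m(1) by (intro corona_eigenvector) auto
  have Lx: "corona_lift \<theta> z ?x \<noteq> 0" if "\<theta> \<noteq> 0" "z u \<noteq> 0" for \<theta> z
    using that by (simp add: corona_lift_def)
  have diff: "\<exists>k::int. \<theta> - \<theta>' = of_int k * (pi / \<tau>)"
    if "graph_eigenvector ?X \<theta> Z" "Z ?x \<noteq> 0" "graph_eigenvector ?X \<theta>' Z'" "Z' ?x \<noteq> 0" for \<theta> \<theta>' Z Z'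
    using eigenvalue_differences_in_lattice[OF eig[OF that(1)] that(2) eig[OF that(3)] that(4) \<open>\<tau> \<noteq> 0\<close>]
    by metis
  have E: "graph_eigenvector ?X (?\<alpha> \<mu>) (corona_lift (?\<alpha> \<mu>) z)"
    "graph_eigenvector ?X (- real m / ?\<alpha> \<mu>) (corona_lift (- real m / ?\<alpha> \<mu>) z)"
    "graph_eigenvector ?X (?\<alpha> \<nu>) (corona_lift (?\<alpha> \<nu>) z')"
    "graph_eigenvector ?X (- real m / ?\<alpha> \<nu>) (corona_lift (- real m / ?\<alpha> \<nu>) z')"
    by (rule L[OF z(1) corona_root_root] L[OF z(1) corona_root_conjugate[OF \<open>m > 0\<close>]]
        L[OF z'(1) corona_root_root] L[OF z'(1) corona_root_conjugate[OF \<open>m > 0\<close>]])+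
  have N: "?\<alpha> \<mu> \<noteq> 0" "- real m / ?\<alpha> \<mu> \<noteq> 0" "?\<alpha> \<nu> \<noteq> 0" "- real m / ?\<alpha> \<nu> \<noteq> 0"
    using \<alpha>_pos[of \<mu>] \<alpha>_pos[of \<nu>] \<open>m > 0\<close> by auto
  have LX: "corona_lift (?\<alpha> \<mu>) z ?x \<noteq> 0" "corona_lift (- real m / ?\<alpha> \<mu>) z ?x \<noteq> 0"
    "corona_lift (?\<alpha> \<nu>) z' ?x \<noteq> 0" "corona_lift (- real m / ?\<alpha> \<nu>) z' ?x \<noteq> 0"
    by (rule Lx; fact)+
  obtain k where k: "?\<alpha> \<mu> + m / ?\<alpha> \<mu> = of_int k * (pi / \<tau>)"
    using diff[OF E(1) LX(1) E(2) LX(2)] by auto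
  obtain l where l: "?\<alpha> \<nu> + m / ?\<alpha> \<nu> = of_int l * (pi / \<tau>)"
    using diff[OF E(3) LX(3) E(4) LX(4)] by auto
  obtain j where j: "?\<alpha> \<mu> - ?\<alpha> \<nu> = of_int j * (pi / \<tau>)"
    using diff[OF E(1) LX(1) E(3) LX(3)] by auto
  have "?\<alpha> \<mu> \<noteq> ?\<alpha> \<nu>" using \<open>\<mu> \<noteq> \<nu>\<close> \<mu>_eq by metis
  then have rat: "?\<alpha> \<mu> * ?\<alpha> \<nu> \<in> \<rat>" "(?\<alpha> \<mu>)\<^sup>2 \<in> \<rat>"
    using lattice_differences_rational[OF \<alpha>_pos \<alpha>_pos _ _ _ k l j] \<open>m > 0\<close> by auto
  have prod: "(?\<alpha> \<mu>)\<^sup>2 * (- real m / ?\<alpha> \<mu>)\<^sup>2 = (real m)\<^sup>2"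
    using N(1) by (simp add: power_divide)
  then have "(- real m / ?\<alpha> \<mu>)\<^sup>2 = (real m)\<^sup>2 / (?\<alpha> \<mu>)\<^sup>2" using N(1) by (simp add: field_simps)
  then have rat': "(- real m / ?\<alpha> \<mu>)\<^sup>2 \<in> \<rat>" using rat(2) by simp
  have "(?\<alpha> \<mu>)\<^sup>2 \<in> \<int>" "(- real m / ?\<alpha> \<mu>)\<^sup>2 \<in> \<int>"
    by (rule graph_eigenvalue_square_integer[OF E(1) LX(1) rat(2)]
        graph_eigenvalue_square_integer[OF E(2) LX(2) rat'])+
  then have "(?\<alpha> \<mu>)\<^sup>2 = 1 \<or> (?\<alpha> \<mu>)\<^sup>2 = m \<or> (?\<alpha> \<mu>)\<^sup>2 = (real m)\<^sup>2"
    using N prod by (intro integer_factor_of_square[OF m(2)]) auto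
  then show "?\<alpha> \<mu> = 1 \<or> (?\<alpha> \<mu>)\<^sup>2 = m \<or> ?\<alpha> \<mu> = m"
    using \<alpha>_pos[of \<mu>] by (auto simp: power2_eq_1_iff)
  show "?\<alpha> \<mu> * ?\<alpha> \<nu> \<in> \<rat>" by (rule rat)
qed

text \<open>
  The root \<open>\<alpha>\<close> cannot be \<open>\<surd>m\<close> for a prime \<open>m\<close>: the root \<open>\<beta>\<close> of a second support eigenvalue would be
  \<open>1\<close> or \<open>m\<close>, and \<open>\<alpha> \<beta>\<close> irrational. The values \<open>\<alpha> = m\<close> and \<open>\<alpha> = 1\<close> belong to the two eigenvalues in the
  conclusion.
\<close>

lemma corona_support_eigenvalues:
  fixes G :: "('v::finite) rel" and \<gamma> :: complex and a :: "'w::finite option"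
  assumes "simple_graph G" "(u, i) \<in> G"
    and m: "CARD('w) = m" "m = 1 \<or> prime m" and "\<tau> \<noteq> 0"
    and rel: "phase_related (corona G (empty_graph :: 'w rel)) \<tau> \<gamma> (u, a) y"
    and z: "graph_eigenvector G \<mu> z" "z u \<noteq> 0"
  shows "m \<noteq> 1 \<and> (\<mu> = real m - 1 \<or> \<mu> = 1 - real m)"
proof -
  let ?\<alpha> = "corona_root m"
  have "m > 0" using m by (metis zero_less_card_finite)
  note \<alpha>_pos = corona_root_pos[OF \<open>m > 0\<close>]
  note \<mu>_eq = eigenvalue_of_corona_root[OF \<open>m > 0\<close>]
  obtain \<nu> z' where z': "graph_eigenvector G \<nu> z'" "z' u \<noteq> 0" "\<nu> \<noteq> \<mu>"
    using support_avoiding_value[OF assms(1,2)] by metis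
  have "?\<alpha> \<mu> \<noteq> ?\<alpha> \<nu>" using z'(3) \<mu>_eq by metis
  have s\<mu>: "?\<alpha> \<mu> * ?\<alpha> \<nu> \<in> \<rat>" "?\<alpha> \<mu> = 1 \<or> (?\<alpha> \<mu>)\<^sup>2 = m \<or> ?\<alpha> \<mu> = m"
    using corona_support_pair[OF m \<open>\<tau> \<noteq> 0\<close> rel z(1) _ z'(1)] z(2) z'(2,3) by blast+
  have s\<nu>: "?\<alpha> \<nu> = 1 \<or> (?\<alpha> \<nu>)\<^sup>2 = m \<or> ?\<alpha> \<nu> = m"
    using corona_support_pair(2)[OF m \<open>\<tau> \<noteq> 0\<close> rel z'(1) _ z(1)] z(2) z'(2,3) by blast
  have "m \<noteq> 1"
  proof
    assume "m = 1"
    then have "?\<alpha> \<mu> = 1" "?\<alpha> \<nu> = 1"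
      using s\<mu> s\<nu> \<alpha>_pos[of \<mu>] \<alpha>_pos[of \<nu>] by (auto simp: power2_eq_1_iff)
    then show False using \<open>?\<alpha> \<mu> \<noteq> ?\<alpha> \<nu>\<close> by simp
  qed
  then have "prime m" using m(2) by simp
  have "(?\<alpha> \<mu>)\<^sup>2 \<noteq> m"
  proof
    assume m: "(?\<alpha> \<mu>)\<^sup>2 = m"
    have "(?\<alpha> \<nu>)\<^sup>2 \<noteq> m"
      using \<open>?\<alpha> \<mu> \<noteq> ?\<alpha> \<nu>\<close> \<alpha>_pos[of \<mu>] \<alpha>_pos[of \<nu>] by (simp flip: m)
    then have "?\<alpha> \<nu> \<in> \<rat>" using s\<nu> by auto
    then have "?\<alpha> \<mu> * ?\<alpha> \<nu> / ?\<alpha> \<nu> \<in> \<rat>" using s\<mu>(1) by (intro Rats_divide)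
    then have "?\<alpha> \<mu> \<in> \<rat>" using \<alpha>_pos[of \<nu>] by simp
    moreover have "?\<alpha> \<mu> = sqrt m" using \<alpha>_pos[of \<mu>] by (simp flip: m)
    then have "algebraic_int (?\<alpha> \<mu>)" by (auto intro: int_imp_algebraic_int)
    ultimately have "?\<alpha> \<mu> \<in> \<int>" by (rule rational_algebraic_int_is_int[rotated])
    then obtain n where "?\<alpha> \<mu> = of_nat n"
      using \<alpha>_pos[of \<mu>] by (metis Ints_cases less_imp_le of_int_0_le_iff of_int_of_nat_eq zero_le_imp_eq_int)
    then have "real (n\<^sup>2) = real m" using m by simp
    then have "n\<^sup>2 = m" by (simp only: of_nat_eq_iff)
    then show False using \<open>prime m\<close> by (simp add: prime_power_iff flip: \<open>n\<^sup>2 = m\<close>)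
  qed
  then show ?thesis using s\<mu>(2) \<mu>_eq[of \<mu>] \<open>m \<noteq> 1\<close> \<open>m > 0\<close> by auto
qed

section \<open>No perfect state transfer\<close>

theorem theorem4p10:
  fixes G :: "('v::finite) rel" and m :: nat
  assumes "simple_graph G" "connected_graph G" "CARD('v) \<ge> 2"
    and "CARD('w::finite) = m" "m = 1 \<or> prime m"
  shows "\<not> (\<exists>u v \<tau>. u \<noteq> v \<and>
    perfect_state_transfer (corona G (empty_graph :: 'w rel)) u v \<tau>)"
proof
  let ?X = "corona G (empty_graph :: 'w rel)"
  assume "\<exists>u v \<tau>. u \<noteq> v \<and> perfect_state_transfer ?X u v \<tau>"
  then obtain x y \<tau> where "x \<noteq> y" and pst: "perfect_state_transfer ?X x y \<tau>" by blast
  define e where "e \<theta> = exp (- \<i> * of_real (\<tau> * \<theta>))" for \<theta>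
  have X: "simple_graph ?X" by (intro simple_graph_corona simple_graph_empty assms)
  then have "sym ?X" by (simp add: simple_graph_def)
  have "sym G" using assms(1) by (simp add: simple_graph_def)
  obtain \<gamma> where \<gamma>: "cmod \<gamma> = 1"
    and rel: "phase_related ?X \<tau> \<gamma> x y"
    using perfect_state_transfer_eigenvectors[OF X pst] by blast
  have eig: "e \<theta> * of_real (Z x) = \<gamma> * of_real (Z y)" if "graph_eigenvector ?X \<theta> Z" for \<theta> Z
    unfolding e_def by (rule phase_relatedD[OF rel that])
  have "\<gamma> \<noteq> 0" using \<gamma> by auto
  have e_neq: "e \<theta> \<noteq> 0" for \<theta> by (simp add: e_def)
  have norm_e: "cmod (e \<theta>) = 1" for \<theta> by (simp add: e_def norm_exp_eq_Re)
  have "m > 0" using assms(4) by (metis zero_less_card_finite)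
  \<comment> \<open>At time \<open>0\<close> the relation would make the basis vectors at \<open>x\<close> and \<open>y\<close> proportional.\<close>
  have "\<tau> \<noteq> 0"
  proof
    assume "\<tau> = 0"
    obtain \<theta> Z where Z: "graph_eigenvector ?X \<theta> Z" "Z x \<noteq> Re \<gamma> * Z y"
      using graph_eigenvectors_separate[OF \<open>sym ?X\<close> \<open>x \<noteq> y\<close>] by metis
    have "of_real (Z x) = \<gamma> * of_real (Z y)" using eig[OF Z(1)] \<open>\<tau> = 0\<close> by (simp add: e_def)
    then show False using Z(2) by (simp add: complex_eq_iff)
  qed

  obtain u a where x: "x = (u, a)" by force
  obtain v b where y: "y = (v, b)" by force
  have L: "graph_eigenvector ?X \<theta> (corona_lift \<theta> z)"
    if "graph_eigenvector G \<mu> z" "\<theta>\<^sup>2 = \<mu> * \<theta> + m" for \<mu> \<theta> z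
    using that assms(4) by (intro corona_eigenvector) auto
  obtain i where ui: "(u, i) \<in> G" using connected_graph_has_neighbour assms(2,3) by metis
  note other = support_avoiding_value[OF assms(1) ui]
  have support: "m \<noteq> 1 \<and> (\<mu> = real m - 1 \<or> \<mu> = 1 - real m)"
    if "graph_eigenvector G \<mu> z" "z u \<noteq> 0" for \<mu> z
    using corona_support_eigenvalues[OF assms(1) ui assms(4,5) \<open>\<tau> \<noteq> 0\<close> rel[unfolded x] that(1)] that(2) .

  obtain \<mu>\<^sub>0 z\<^sub>0 where "graph_eigenvector G \<mu>\<^sub>0 z\<^sub>0" "z\<^sub>0 u \<noteq> 0" using other by metis
  then have "m \<noteq> 1" using support by blast
  then have "prime m" using assms(5) by simp
  then have "m \<ge> 2" by (rule prime_ge_2_nat)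
  have e_add: "e (s + t) = e s * e t" for s t
    by (simp add: e_def algebra_simps flip: exp_add)
  have e_minus: "e (- t) = 1 / e t" for t
    by (simp add: e_def exp_minus divide_inverse)
  obtain p zp where p: "graph_eigenvector G p zp" "zp u \<noteq> 0" "p \<noteq> 1 - real m" using other by metis
  obtain q zq where q: "graph_eigenvector G q zq" "zq u \<noteq> 0" "q \<noteq> real m - 1" using other by metis
  have pq: "p = real m - 1" "q = 1 - real m" using support p q by blast+

  \<comment> \<open>The lifts of an eigenvector for \<open>m - 1\<close> belong to \<open>m\<close> and \<open>- 1\<close>, those of an eigenvector for
    \<open>1 - m\<close> to \<open>- m\<close> and \<open>1\<close>.\<close>
  have pos: "e \<theta> * of_real (corona_lift \<theta> z x) = \<gamma> * of_real (corona_lift \<theta> z y)"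
    if "graph_eigenvector G (real m - 1) z" "\<theta> = real m \<or> \<theta> = - 1" for z and \<theta> :: real
    using that by (intro eig L[OF that(1)]) (auto simp: power2_eq_square algebra_simps)
  have neg: "e \<theta> * of_real (corona_lift \<theta> z x) = \<gamma> * of_real (corona_lift \<theta> z y)"
    if "graph_eigenvector G (1 - real m) z" "\<theta> = - real m \<or> \<theta> = 1" for z and \<theta> :: real
    using that by (intro eig L[OF that(1)]) (auto simp: power2_eq_square algebra_simps)

  \<comment> \<open>Used with \<open>A = {}\<close> for a second leaf and, if \<open>m > 2\<close>, with \<open>A = {w'}\<close> for a third one.\<close>
  have twin: "\<exists>w'. w' \<noteq> w \<and> w' \<notin> A" if "card A + 1 < m" for w :: 'w and A
  proof (rule ccontr)
    assume "\<not> ?thesis"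
    then have "UNIV = insert w A" by auto
    then have "CARD('w) = card (insert w A)" by simp
    also have "\<dots> \<le> card A + 1" by (simp add: card_insert_if)
    finally show False using that assms(4) by simp
  qed
  have twin1: "\<exists>w'. w' \<noteq> w" for w :: 'w using twin[of "{}" w] \<open>m \<ge> 2\<close> by auto

  show False
  proof (cases a)
    case (Some w)
    \<comment> \<open>The difference of the leaves \<open>w\<close> and \<open>w'\<close> is nonzero at \<open>x\<close>, hence also at \<open>y\<close>.\<close>
    have y_twin: "y = (u, Some w')" if "w' \<noteq> w" for w'
      using eig[OF corona_twin_eigenvector[of w w' G u]] that e_neq \<open>x \<noteq> y\<close>
      by (auto simp: x Some split: if_splits)
    obtain w' where w': "w' \<noteq> w" using twin1 by blast
    \<comment> \<open>A third leaf \<open>w''\<close> would also have to be the target \<open>y\<close>.\<close>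
    have "m = 2"
    proof (rule ccontr)
      assume "m \<noteq> 2"
      then obtain w'' where "w'' \<noteq> w" "w'' \<noteq> w'" using twin[of "{w'}" w] \<open>m \<ge> 2\<close> by auto
      then show False using y_twin[OF w'] y_twin[of w''] by auto
    qed
    have "\<gamma> = - 1"
      using eig[OF corona_twin_eigenvector[of w w' G u]] w' y_twin[OF w']
      by (simp add: x Some e_def minus_equation_iff)
    have "e \<theta> * of_real (zp u) = - 1 * of_real (zp u)" if "\<theta> = 2 \<or> \<theta> = - 1" for \<theta>
      using pos[of zp \<theta>] that p y_twin[OF w']
      by (auto simp: pq \<open>m = 2\<close> x Some corona_lift_def \<open>\<gamma> = - 1\<close>)
    then have "e \<theta> = - 1" if "\<theta> = 2 \<or> \<theta> = - 1" for \<theta>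
      using that p(2) by (metis mult_right_cancel of_real_eq_0_iff)
    then have "e 2 = - 1" "e (- 1) = - 1" by blast+
    moreover have "e 1 = - 1" using e_minus[of "- 1"] \<open>e (- 1) = - 1\<close> by simp
    ultimately show False using e_add[of 1 1] by simp
  next
    case None
    have "b = None"
    proof (rule ccontr)
      assume "b \<noteq> None"
      then obtain w where b: "b = Some w" by auto
      obtain w' where w': "w' \<noteq> w" using twin1 by blast
      show False
        using eig[OF corona_twin_eigenvector[of w w' G v]] w' \<open>\<gamma> \<noteq> 0\<close> by (simp add: x y None b)
    qed
    then have "u \<noteq> v" using \<open>x \<noteq> y\<close> by (simp add: x y None)
    have pos': "e \<theta> * of_real (z u) = \<gamma> * of_real (z v)"
      if "graph_eigenvector G (real m - 1) z" "\<theta> = real m \<or> \<theta> = - 1" for z and \<theta> :: real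
      using pos[OF that] that(2) \<open>m > 0\<close> by (auto simp: corona_lift_def x y None \<open>b = None\<close>)
    have neg': "e \<theta> * of_real (z u) = \<gamma> * of_real (z v)"
      if "graph_eigenvector G (1 - real m) z" "\<theta> = - real m \<or> \<theta> = 1" for z and \<theta> :: real
      using neg[OF that] that(2) \<open>m > 0\<close> by (auto simp: corona_lift_def x y None \<open>b = None\<close>)
    define s where "s = zp v / zp u"
    define s' where "s' = zq v / zq u"
    have es: "e (- 1) = \<gamma> * of_real s" "e m = \<gamma> * of_real s"
      using pos'[of zp "- 1"] pos'[of zp "real m"] p by (simp_all add: pq s_def eq_divide_eq)
    have es': "e 1 = \<gamma> * of_real s'" "e (- real m) = \<gamma> * of_real s'"
      using neg'[of zq 1] neg'[of zq "- real m"] q by (simp_all add: pq s'_def eq_divide_eq)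
    have abs: "\<bar>s\<bar> = 1" "\<bar>s'\<bar> = 1"
      using arg_cong[OF es(1), of cmod] arg_cong[OF es'(1), of cmod] \<gamma>
      by (simp_all add: norm_e norm_mult)
    have sign: "(\<mu> = real m - 1 \<and> z v = s * z u) \<or> (\<mu> = 1 - real m \<and> z v = s' * z u)
        \<or> (z u = 0 \<and> z v = 0)"
      if z: "graph_eigenvector G \<mu> z" for \<mu> z
    proof (cases "z u = 0")
      case True
      have "corona_lift (corona_root m \<mu>) z x = 0" using True by (simp add: corona_lift_def x)
      then have "corona_lift (corona_root m \<mu>) z y = 0"
        using eig[OF L[OF z corona_root_root]] \<open>\<gamma> \<noteq> 0\<close> by simp
      then have "z v = 0"
        using corona_root_pos[OF \<open>m > 0\<close>, of \<mu>] by (simp add: corona_lift_def y \<open>b = None\<close>)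
      then show ?thesis using True by simp
    next
      case False
      then consider "\<mu> = real m - 1" | "\<mu> = 1 - real m" using support[OF z] by blast
      then show ?thesis
      proof cases
        case 1
        then have "\<gamma> * of_real (s * z u) = \<gamma> * of_real (z v)"
          using pos'[of z "- 1"] z by (simp add: es)
        then have "of_real (s * z u) = (of_real (z v) :: complex)"
          using mult_left_cancel[OF \<open>\<gamma> \<noteq> 0\<close>] by blast
        then have "s * z u = z v" by (simp only: of_real_eq_iff)
        then show ?thesis using 1 by simp
      next
        case 2
        then have "\<gamma> * of_real (s' * z u) = \<gamma> * of_real (z v)"
          using neg'[of z 1] z by (simp add: es')
        then have "of_real (s' * z u) = (of_real (z v) :: complex)"
          using mult_left_cancel[OF \<open>\<gamma> \<noteq> 0\<close>] by blast
        then have "s' * z u = z v" by (simp only: of_real_eq_iff)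
        then show ?thesis using 2 by simp
      qed
    qed
    show False
    proof (cases "s' = s")
      case True
      obtain \<mu> z where z: "graph_eigenvector G \<mu> z" "z v \<noteq> s * z u"
        using graph_eigenvectors_separate[OF \<open>sym G\<close>, of v u s] \<open>u \<noteq> v\<close> by metis
      then show False using sign[OF z(1)] True by auto
    next
      case False
      then have s': "s' = - s" and ss: "s * s = 1" using abs by (auto simp: abs_if split: if_splits)
      have "\<mu> * z u = (real m - 1) * s * z v" if z: "graph_eigenvector G \<mu> z" for \<mu> z
      proof -
        have "s * (s * r) = r" for r using ss by (simp flip: mult.assoc)
        note [simp] = this
        show ?thesis using sign[OF z] by (auto simp: s' mult.assoc left_diff_distrib)
      qed
      from neighbours_if_eigenvectors_proportional[of G u "(real m - 1) * s" v i, OF \<open>sym G\<close> this]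
      have "1 = (if i = v then (real m - 1) * s else 0)" using ui by simp
      then have "(real m - 1) * s = 1" by (simp split: if_splits)
      then have "\<bar>real m - 1\<bar> * \<bar>s\<bar> = 1" by (metis abs_mult abs_one)
      then have "m = 2" using \<open>m \<ge> 2\<close> by (simp add: abs)
      have sq: "e 1 * e 1 = e (- 1)" using es \<open>m = 2\<close> e_add[of 1 1] by simp
      have e1: "e 1 = - e (- 1)" using es es' by (simp add: s')
      have "e (- 1) = - 1 * e 1" using e1 by (metis minus_minus mult_minus1)
      with sq have "e 1 * e 1 = - 1 * e 1" by (rule trans)
      then have "e 1 = - 1" using mult_right_cancel[OF e_neq] by blast
      moreover have "e (- 1) = 1" using e1 \<open>e 1 = - 1\<close> by (metis neg_equal_iff_equal)
      ultimately show False using e_minus[of 1] by simp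
    qed
  qed
qed

end
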